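(* Let $K,L,T$ be positive integers with $2KL-K-L-\min\{K,L\}+3\le T$. Then every normal degree table $(\alpha^*,\beta^* )\in\mathcal{A}(K,L,T)$ with $\operatorname{N}(\alpha^*,\beta^* )=\operatorname{N}(K,L,T)$ has largest entry of $\alpha^*$ at most $2KL+T-1-L$ and largest entry of $\beta^*$ at most $2KL+T-1-K$.
   Context: A degree table with parameters $K,L,T$ is a tuple $(\alpha_{\mathrm p},\alpha_{\mathrm s},\beta_{\mathrm p},\beta_{\mathrm s})$ of nonnegative integer vectors of lengths $K,T,L,T$ such that, with $\alpha=(\alpha_{\mathrm p}\mid\alpha_{\mathrm s})$, $\beta=(\beta_{\mathrm p}\mid\beta_{\mathrm s})$: (i) entries of $\alpha$ are distinct; (ii) entries of $\beta$ are distinct; (iii) for every integer $n\in\operatorname{Set}(\alpha_{\mathrm p})+\operatorname{Set}(\beta_{\mathrm p})$ there is a unique $i\in\operatorname{Set}(\alpha)$ and unique $j\in\operatorname{Set}(\beta)$ with $n=i+j$. $\operatorname{Set}(v)$ is the set of entries of $v$, $A+B=\{a+b\}$. $\mathcal{A}(K,L,T)$ is the set of degree tables, $\operatorname{N}(\alpha,\beta)=|\operatorname{Set}(\alpha)+\operatorname{Set}(\beta)|$, and $\operatorname{N}(K,L,T)=\min_{(\alpha,\beta)\in\mathcal{A}(K,L,T)}\operatorname{N}(\alpha,\beta)$. A degree table is normal if each of $\alpha_{\mathrm p},\alpha_{\mathrm s},\beta_{\mathrm p},\beta_{\mathrm s}$ is sorted in increasing order, the smallest entry of $\alpha$ is $0$,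 the smallest entry of $\beta$ is $0$, and the greatest common divisor of all entries of $\alpha_{\mathrm p},\alpha_{\mathrm s},\beta_{\mathrm p},\beta_{\mathrm s}$ is $1$. *)

theory Defs
  imports Main
begin

text \<open>A degree table with parameters K, L, T: vectors (lists of naturals)
  ap (length K), as (length T), bp (length L), bs (length T).
  alpha = ap @ as, beta = bp @ bs.\<close>

definition sumset :: "nat set \<Rightarrow> nat set \<Rightarrow> nat set" where
  "sumset A B = {a + b | a b. a \<in> A \<and> b \<in> B}"

definition degree_table ::
  "nat \<Rightarrow> nat \<Rightarrow> nat \<Rightarrow> nat list \<Rightarrow> nat list \<Rightarrow> nat list \<Rightarrow> nat list \<Rightarrow> bool" where
  "degree_table K L T ap as bp bs \<longleftrightarrow>
     length ap = K \<and> length as = T \<and> length bp = L \<and> length bs = T \<and>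
     distinct (ap @ as) \<and> distinct (bp @ bs) \<and>
     (\<forall>n \<in> sumset (set ap) (set bp).
        \<exists>!p. p \<in> set (ap @ as) \<times> set (bp @ bs) \<and> fst p + snd p = n)"

definition N_tab :: "nat list \<Rightarrow> nat list \<Rightarrow> nat list \<Rightarrow> nat list \<Rightarrow> nat" where
  "N_tab ap as bp bs = card (sumset (set (ap @ as)) (set (bp @ bs)))"

definition N_min :: "nat \<Rightarrow> nat \<Rightarrow> nat \<Rightarrow> nat" where
  "N_min K L T = (LEAST m. \<exists>ap as bp bs. degree_table K L T ap as bp bs \<and> N_tab ap as bp bs = m)"

definition normal_table :: "nat list \<Rightarrow> nat list \<Rightarrow> nat list \<Rightarrow> nat list \<Rightarrow> bool" where
  "normal_table ap as bp bs \<longleftrightarrow>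
     sorted ap \<and> sorted as \<and> sorted bp \<and> sorted bs \<and>
     Min (set (ap @ as)) = 0 \<and> Min (set (bp @ bs)) = 0 \<and>
     Gcd (set (ap @ as @ bp @ bs)) = 1"

end

theory Submission
  imports Defs "HOL-Library.Set_Algebras"
begin

text \<open>
  Put A = Set \<alpha>, B = Set \<beta>, a = max A, b = max B, say b \<le> a. An explicit table gives
  N(K, L, T) \<le> 2KL + 2T - 1, so it suffices to show a + |B| \<le> |A + B| and b + |A| \<le> |A + B|;
  by the hypothesis on T this is Freiman's 3k-4 theorem for two distinct sets, in the range
  |A + B| \<le> |A| + |B| + min(|A|, |B|) - 4.
  If A + B covers all residues modulo a, then a + |B| \<le> |A + B|, since each y in B has a second
  representative y + a of its class in A + B. Otherwise Kneser's theorem in the integers modulo a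
  provides a divisor d > 1 of a modulo which A + B is periodic, and adding up over the classes
  modulo d contradicts the upper bound on |A + B|. The first bound makes A so dense in [0, a]
  that A + B also covers all residues modulo b, which yields the second one.
\<close>

section \<open>Kneser's theorem for cyclic groups\<close>

text \<open>A subset of the integers modulo n is represented by an n-periodic set of integers, counted
  on {0..<n}; the subgroups are the multiples of d for the divisors d of n.\<close>

definition periodic :: "int \<Rightarrow> int set \<Rightarrow> bool" where
  "periodic d X \<longleftrightarrow> (\<forall>x. x + d \<in> X \<longleftrightarrow> x \<in> X)"

section \<open>Periods of sets of integers and counting over one period\<close>

lemma periodic_mult:
  assumes "periodic d X"
  shows "x + k * d \<in> X \<longleftrightarrow> x \<in> X"
proof (induction k rule: int_induct[where k = 0])
  case base
  then show ?case by simp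
next
  case (step1 i)
  have "x + (i + 1) * d = (x + i * d) + d" by (simp add: algebra_simps)
  then show ?case using assms step1 unfolding periodic_def by metis
next
  case (step2 i)
  have "x + i * d = (x + (i - 1) * d) + d" by (simp add: algebra_simps)
  then show ?case using assms step2 unfolding periodic_def by metis
qed

lemma periodic_dvd: "periodic d X \<Longrightarrow> d dvd n \<Longrightarrow> periodic n X"
  by (metis dvdE mult.commute periodic_def periodic_mult)

lemma periodic_cong:
  assumes "periodic d X" "x mod d = y mod d"
  shows "x \<in> X \<longleftrightarrow> y \<in> X"
proof -
  obtain k where "x = y + d * k" using assms(2) by (metis mod_eqE add_diff_cancel_left' diff_add_cancel add.commute)
  then show ?thesis using periodic_mult[OF assms(1), of y k] by (simp add: mult.commute)
qed

lemma periodic_mod: "periodic d X \<Longrightarrow> x mod d \<in> X \<longleftrightarrow> x \<in> X"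
  by (rule periodic_cong) auto

lemma periodic_diff: "periodic a X \<Longrightarrow> periodic b X \<Longrightarrow> periodic (a - b) X"
  unfolding periodic_def by (metis add.assoc diff_add_cancel)

lemma periodic_Un: "periodic d X \<Longrightarrow> periodic d Y \<Longrightarrow> periodic d (X \<union> Y)"
  by (auto simp: periodic_def)

lemma periodic_translate: "periodic d X \<Longrightarrow> periodic d {x. x - e \<in> X}"
  unfolding periodic_def by (metis add_diff_eq diff_add_eq mem_Collect_eq)

lemma periodic_sumset: "periodic d X \<Longrightarrow> periodic d (X + Y)"
proof -
  assume a: "periodic d X"
  have "x + d \<in> X + Y \<longleftrightarrow> x \<in> X + Y" for x
  proof
    assume "x + d \<in> X + Y"
    then obtain u v where "u \<in> X" "v \<in> Y" "x + d = u + v" by (auto elim: set_plus_elim)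
    moreover from this have "u - d \<in> X" using a unfolding periodic_def by (metis diff_add_cancel)
    moreover have "x = (u - d) + v" using calculation by simp
    ultimately show "x \<in> X + Y" by blast
  next
    assume "x \<in> X + Y"
    then obtain u v where "u \<in> X" "v \<in> Y" "x = u + v" by (auto elim: set_plus_elim)
    moreover from this have "u + d \<in> X" using a unfolding periodic_def by metis
    moreover have "x + d = (u + d) + v" using calculation by simp
    ultimately show "x + d \<in> X + Y" by (metis set_plus_intro)
  qed
  then show ?thesis by (simp add: periodic_def)
qed

text \<open>Adding \<open>h\<close> another \<open>n - 1\<close> times leads from
  \<open>x + h\<close> to \<open>x + h * n\<close>, which lies in \<open>X\<close> only if
  \<open>x\<close> does, because \<open>h * n\<close> is a multiple of the period
  \<open>n\<close>.\<close>

lemma periodic_if_stable: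
  assumes "periodic n X" "n > 0" and st: "\<And>x. x \<in> X \<Longrightarrow> x + h \<in> X"
  shows "periodic h X"
proof -
  have it: "x + int k * h \<in> X" if "x \<in> X" for x k
  proof (induction k)
    case (Suc k)
    then show ?case using st[OF Suc] by (simp add: algebra_simps)
  qed (use that in simp)
  have "x \<in> X" if "x + h \<in> X" for x
  proof -
    have "x + h * n = (x + h) + int (nat (n - 1)) * h" using \<open>n > 0\<close> by (simp add: algebra_simps)
    then have "x + h * n \<in> X" using it[OF that] by metis
    then show ?thesis using periodic_mult[OF assms(1)] by simp
  qed
  then show ?thesis using st by (auto simp: periodic_def)
qed

text \<open>The periods form a subgroup of the integers; division with remainder shows that the
  least positive one generates it.\<close>

lemma obtain_least_period:
  assumes "periodic n X" "n > 0"
  obtains d where "d > 0" "periodic d X" "\<And>h. periodic h X \<Longrightarrow> d dvd h"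
proof -
  define d where "d = int (LEAST k. k > 0 \<and> periodic (int k) X)"
  have "0 < nat n \<and> periodic (int (nat n)) X" using assms by simp
  then have "d > 0 \<and> periodic d X"
    unfolding d_def by (metis (mono_tags, lifting) LeastI of_nat_0_less_iff)
  then have d: "d > 0" "periodic d X" by auto
  have "d dvd h" if "periodic h X" for h
  proof (rule ccontr)
    assume nd: "\<not> d dvd h"
    have "periodic (h - (h div d) * d) X"
      using d(2) that periodic_diff periodic_dvd by (metis dvd_triv_right)
    then have "periodic (h mod d) X" by (simp add: minus_div_mult_eq_mod)
    moreover have "h mod d > 0" "h mod d < d"
      using nd d(1) pos_mod_sign[OF d(1), of h] by (auto simp: dvd_eq_mod_eq_0 simp del: pos_mod_sign)
    ultimately have "0 < nat (h mod d) \<and> periodic (int (nat (h mod d))) X" by simp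
    then have "(LEAST k. k > 0 \<and> periodic (int k) X) \<le> nat (h mod d)" by (rule Least_le)
    then show False using \<open>h mod d < d\<close> \<open>h mod d > 0\<close> unfolding d_def by linarith
  qed
  then show ?thesis using that d by blast
qed

lemma card_translate:
  assumes "periodic n X" "n > 0"
  shows "card ({x. x - e \<in> X} \<inter> {0..<n}) = card (X \<inter> {0..<n})"
proof (rule bij_betw_same_card)
  show "bij_betw (\<lambda>x. (x - e) mod n) ({x. x - e \<in> X} \<inter> {0..<n}) (X \<inter> {0..<n})"
  proof (rule bij_betw_byWitness[where f' = "\<lambda>x. (x + e) mod n"])
    show "(\<lambda>x. (x + e) mod n) ` (X \<inter> {0..<n}) \<subseteq> {x. x - e \<in> X} \<inter> {0..<n}"
    proof safe
      fix x assume "x \<in> X" "x \<in> {0..<n}"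
      have "((x + e) mod n - e) mod n = x mod n" by (simp add: mod_diff_left_eq)
      then show "(x + e) mod n - e \<in> X" using periodic_cong[OF assms(1)] \<open>x \<in> X\<close> by blast
    qed (use assms in auto)
  qed (use assms in \<open>auto simp: periodic_mod mod_simps\<close>)
qed

lemma card_scale:
  assumes "periodic l X" "l > 0"
  shows "card (X \<inter> {0..<int m * l}) = m * card (X \<inter> {0..<l})"
proof (induction m)
  case (Suc m)
  let ?f = "\<lambda>x. x + int m * l"
  have im: "?f ` (X \<inter> {0..<l}) = X \<inter> {int m * l..<int (Suc m) * l}"
  proof (intro equalityI subsetI)
    fix y assume y: "y \<in> X \<inter> {int m * l..<int (Suc m) * l}"
    have "y - int m * l \<in> X" using y periodic_mult[OF assms(1), of "y - int m * l" "int m"] by simp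
    then show "y \<in> ?f ` (X \<inter> {0..<l})"
      using y by (intro image_eqI[of _ _ "y - int m * l"]) (auto simp: algebra_simps)
  qed (use periodic_mult[OF assms(1)] in \<open>auto simp: distrib_right\<close>)
  have "X \<inter> {0..<int (Suc m) * l} = (X \<inter> {0..<int m * l}) \<union> ?f ` (X \<inter> {0..<l})"
    unfolding im Int_Un_distrib[symmetric] using assms(2)
    by (subst ivl_disj_un_two(3)) (auto simp: distrib_right)
  moreover have "(X \<inter> {0..<int m * l}) \<inter> ?f ` (X \<inter> {0..<l}) = {}"
    unfolding im by auto
  moreover have "card (?f ` (X \<inter> {0..<l})) = card (X \<inter> {0..<l})"
    by (rule card_image) (simp add: inj_on_def)
  ultimately show ?case using Suc by (simp add: card_Un_disjoint)
qed simp

lemma card_residue_class: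
  fixes d n c :: int
  assumes "d > 0" "d dvd n" "n > 0"
  shows "int (card ({x. x mod d = c mod d} \<inter> {0..<n})) = n div d"
proof -
  have p: "periodic d {x. x mod d = c mod d}" by (simp add: periodic_def)
  have "{x. x mod d = c mod d} \<inter> {0..<d} = {c mod d}" using assms(1) by auto
  moreover have "n = int (nat (n div d)) * d" using assms by (simp add: pos_imp_zdiv_nonneg_iff)
  ultimately have "card ({x. x mod d = c mod d} \<inter> {0..<n}) = nat (n div d)"
    using card_scale[OF p assms(1), of "nat (n div d)"] by simp
  then show ?thesis using assms by (simp add: pos_imp_zdiv_nonneg_iff)
qed

section \<open>Kneser's bound and unions\<close>

text \<open>For \<open>N\<close> = |A| + |B| and \<open>C\<close> = A + B this is Kneser's
  inequality, \<open>n div d\<close> being the order of the subgroup generated by \<open>d\<close>.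
  With \<open>N\<close> as a parameter, the bound can be proved for pieces of A + B and then carried
  over to their union.\<close>

definition kneser_bound :: "int \<Rightarrow> int \<Rightarrow> int set \<Rightarrow> bool" where
  "kneser_bound n N C \<longleftrightarrow>
     (\<exists>d>0. d dvd n \<and> periodic d C \<and> N \<le> int (card (C \<inter> {0..<n})) + n div d)"

text \<open>The product is concave in \<open>x\<close>, so its least value on 1, ...,
  \<open>m - 1\<close> is taken at the ends.\<close>

lemma mult_pred_ge:
  fixes x m :: int
  assumes "1 \<le> x" "x < m"
  shows "m - 1 \<le> x * (m - x)"
proof -
  have "0 \<le> (x - 1) * (m - x - 1)" using assms by simp
  then show ?thesis by (simp add: algebra_simps)
qed

text \<open>The class of c modulo gcd d1 d2 is a grid of l div d1 times l div d2 residues modulo l; in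
  it C2 consists of v full lines in one direction and C1 of u full lines in the other.\<close>

lemma grid_bound:
  fixes d1 d2 :: int
  defines "l \<equiv> lcm d1 d2"
  assumes "d1 > 0" "d2 > 0" "periodic d1 C1" "periodic d2 C2" "c \<in> C2" "c \<notin> C1"
  shows "l div d1 \<le> int (card ((C2 - C1) \<inter> {0..<l})) + 1 \<or>
         l div d2 \<le> int (card ((C1 - C2) \<inter> {0..<l})) + 1 \<or>
         l div d2 \<le> int (card ((C2 - C1) \<inter> {0..<l}))"
proof -
  define n1 n2 where "n1 = l div d1" and "n2 = l div d2"
  have lpos: "l > 0" using assms(2,3) by (simp add: l_def lcm_pos_int)
  have l1: "l = n1 * d1" and l2: "l = n2 * d2" by (simp_all add: n1_def n2_def l_def)
  have npos: "n1 > 0" "n2 > 0"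
    using lpos l1 l2 assms(2,3) by (metis zero_less_mult_pos2)+
  let ?f = "\<lambda>(i, j). (c + d1 * i + d2 * j) mod l"
  have inj: "inj_on ?f ({0..<n1} \<times> {0..<n2})"
  proof (rule inj_onI, clarify)
    fix i j i' j' assume ij: "i \<in> {0..<n1}" "j \<in> {0..<n2}" "i' \<in> {0..<n1}" "j' \<in> {0..<n2}"
      and e: "(c + d1 * i + d2 * j) mod l = (c + d1 * i' + d2 * j') mod l"
    \<comment> \<open>\<open>d2\<close> divides the whole combination and its second summand, hence
      also \<open>d1 * (i - i')\<close>, which is thus a multiple of \<open>d1\<close> and
      \<open>d2\<close>, and so of \<open>l\<close>. The other summand is treated in the same
      way.\<close>
    have ld: "l dvd d1 * (i - i') + d2 * (j - j')"
      using mod_eq_dvd_iff[THEN iffD1, OF e] by (simp add: algebra_simps)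
    have "d2 dvd l" "d1 dvd l" by (simp_all add: l_def)
    then have "d2 dvd d1 * (i - i')" "d1 dvd d2 * (j - j')"
      using dvd_trans[OF _ ld] dvd_add_left_iff dvd_add_right_iff by (metis dvd_triv_left)+
    then have "l dvd d1 * (i - i')" "l dvd d2 * (j - j')" by (simp_all add: l_def)
    then have "n1 dvd i - i'" "n2 dvd j - j'"
      using l1 assms(2) l2 assms(3) by (metis dvd_mult_cancel_left less_irrefl mult.commute)+
    moreover have "\<bar>i - i'\<bar> < n1" "\<bar>j - j'\<bar> < n2" using ij by auto
    ultimately show "i = i' \<and> j = j'"
      using zdvd_imp_le[of n1 "\<bar>i - i'\<bar>"] zdvd_imp_le[of n2 "\<bar>j - j'\<bar>"] by fastforce
  qed
  \<comment> \<open>On the grid, membership in \<open>C1\<close> depends only on \<open>j\<close>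
    and membership in \<open>C2\<close> only on \<open>i\<close>, so \<open>C2 - C1\<close> and
    \<open>C1 - C2\<close> contain full rectangles of cells.\<close>
  have m1: "(c + d1 * i + d2 * j) mod l \<in> C1 \<longleftrightarrow> c + d2 * j \<in> C1" for i j
    by (rule periodic_cong[OF assms(4)]) (metis l_def dvd_lcm1 mod_mod_cancel mod_mult_self2 add.assoc add.commute)
  have m2: "(c + d1 * i + d2 * j) mod l \<in> C2 \<longleftrightarrow> c + d1 * i \<in> C2" for i j
    by (rule periodic_cong[OF assms(5)]) (metis l_def dvd_lcm2 mod_mod_cancel mod_mult_self2)
  define I J where "I = {i \<in> {0..<n1}. c + d1 * i \<in> C2}" and "J = {j \<in> {0..<n2}. c + d2 * j \<in> C1}"
  define v u where "v = int (card I)" and "u = int (card J)"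
  have IJ: "I \<subseteq> {0..<n1}" "J \<subseteq> {0..<n2}" by (auto simp: I_def J_def)
  then have fin: "finite I" "finite J" by (meson finite_atLeastLessThan_int finite_subset)+
  have cI: "int (card ({0..<n1} - I)) = n1 - v"
    using npos fin IJ card_mono[OF _ IJ(1)] by (simp add: v_def card_Diff_subset)
  have cJ: "int (card ({0..<n2} - J)) = n2 - u"
    using npos fin IJ card_mono[OF _ IJ(2)] by (simp add: u_def card_Diff_subset)
  have "0 \<in> I" using npos assms(6) by (simp add: I_def)
  then have v1: "v \<ge> 1" using fin by (metis card_gt_0_iff empty_iff int_one_le_iff_zero_less of_nat_0_less_iff v_def)
  have "0 \<in> {0..<n2} - J" using npos assms(7) by (simp add: J_def)
  then have un: "u < n2" using cJ fin
    by (metis card_gt_0_iff diff_gt_0_iff_gt empty_iff finite_Diff finite_atLeastLessThan_int of_nat_0_less_iff)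
  have vn: "v \<le> n1" using cI by linarith
  have b: "v * (n2 - u) \<le> int (card ((C2 - C1) \<inter> {0..<l}))"
  proof -
    have "?f ` (I \<times> ({0..<n2} - J)) \<subseteq> (C2 - C1) \<inter> {0..<l}"
      using lpos m1 m2 by (auto simp: I_def J_def)
    then have "card (?f ` (I \<times> ({0..<n2} - J))) \<le> card ((C2 - C1) \<inter> {0..<l})"
      by (intro card_mono) auto
    moreover have inj': "inj_on ?f (I \<times> ({0..<n2} - J))"
      using IJ by (intro inj_on_subset[OF inj]) auto
    have "int (card (?f ` (I \<times> ({0..<n2} - J)))) = v * (n2 - u)"
      unfolding card_image[OF inj'] card_cartesian_product of_nat_mult cJ v_def ..
    ultimately show ?thesis by linarith
  qed
  have b': "u * (n1 - v) \<le> int (card ((C1 - C2) \<inter> {0..<l}))"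
  proof -
    have "?f ` (({0..<n1} - I) \<times> J) \<subseteq> (C1 - C2) \<inter> {0..<l}"
      using lpos m1 m2 by (auto simp: I_def J_def)
    then have "card (?f ` (({0..<n1} - I) \<times> J)) \<le> card ((C1 - C2) \<inter> {0..<l})"
      by (intro card_mono) auto
    moreover have inj': "inj_on ?f (({0..<n1} - I) \<times> J)"
      using IJ by (intro inj_on_subset[OF inj]) auto
    have "int (card (?f ` (({0..<n1} - I) \<times> J))) = u * (n1 - v)"
      unfolding card_image[OF inj'] card_cartesian_product of_nat_mult cI u_def by simp
    ultimately show ?thesis by linarith
  qed
  consider "u = 0" | "u \<ge> 1" "v = n1" | "u \<ge> 1" "v < n1"
    using vn u_def by linarith
  then show ?thesis
  proof cases
    case 1
    have "1 * n2 \<le> v * n2" using v1 npos by (intro mult_right_mono) auto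
    then show ?thesis using b 1 n2_def by simp
  next
    case 2
    have "n1 * 1 \<le> n1 * (n2 - u)" using un npos by (intro mult_left_mono) auto
    then show ?thesis using b 2 n1_def by simp
  next
    case 3
    \<comment> \<open>Multiplying both inequalities and regrouping the factors into
      \<open>v * (n1 - v)\<close> and \<open>u * (n2 - u)\<close> contradicts
      \<open>mult_pred_ge\<close>.\<close>
    have "\<not> (v * (n2 - u) < n1 - 1 \<and> u * (n1 - v) < n2 - 1)"
    proof
      assume s: "v * (n2 - u) < n1 - 1 \<and> u * (n1 - v) < n2 - 1"
      have "(v * (n2 - u)) * (u * (n1 - v)) < (n1 - 1) * (n2 - 1)"
        using s v1 un 3 by (intro mult_strict_mono) auto
      moreover have "(n1 - 1) * (n2 - 1) \<le> (v * (n1 - v)) * (u * (n2 - u))"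
        using v1 un 3 by (intro mult_mono mult_pred_ge) auto
      ultimately show False by (simp add: algebra_simps)
    qed
    then show ?thesis using b b' n1_def n2_def by linarith
  qed
qed

text \<open>The union has period \<open>l = lcm d1 d2\<close>, and counts modulo \<open>n\<close>
  are \<open>n div l\<close> times those modulo \<open>l\<close>. It therefore suffices that, modulo
  \<open>l\<close>, |C1| + \<open>l div d1\<close> or |C2| + \<open>l div d2\<close> exceeds the
  size of the union by at most 1; if neither set contains the other, \<open>grid_bound\<close>
  provides this.\<close>

lemma kneser_bound_Un:
  assumes "n > 0" "kneser_bound n N C1" "kneser_bound n N C2"
  shows "kneser_bound n N (C1 \<union> C2)"
proof (cases "C1 \<subseteq> C2 \<or> C2 \<subseteq> C1")
  case True
  then show ?thesis using assms by (metis sup.absorb1 sup.absorb2)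
next
  case False
  obtain d1 where d1: "d1 > 0" "d1 dvd n" "periodic d1 C1" "N \<le> int (card (C1 \<inter> {0..<n})) + n div d1"
    using assms(2) unfolding kneser_bound_def by blast
  obtain d2 where d2: "d2 > 0" "d2 dvd n" "periodic d2 C2" "N \<le> int (card (C2 \<inter> {0..<n})) + n div d2"
    using assms(3) unfolding kneser_bound_def by blast
  define l where "l = lcm d1 d2"
  define m where "m = n div l"
  have lpos: "l > 0" using d1 d2 by (simp add: l_def lcm_pos_int)
  have "l dvd n" using d1 d2 by (simp add: l_def)
  then have n: "n = m * l" by (simp add: m_def)
  then have mpos: "m > 0" using lpos assms(1) zero_less_mult_pos2 by blast
  have p: "periodic l C1" "periodic l C2" using d1 d2 periodic_dvd by (auto simp: l_def)
  have sc: "int (card (X \<inter> {0..<n})) = m * int (card (X \<inter> {0..<l}))" if "periodic l X" for X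
    using card_scale[OF that lpos, of "nat m"] mpos n by simp
  have q: "n div d1 = m * (l div d1)" "n div d2 = m * (l div d2)" "n div l = m"
    using n lpos by (auto simp: l_def div_mult_swap)
  obtain c c' where c: "c \<in> C2" "c \<notin> C1" "c' \<in> C1" "c' \<notin> C2" using False by blast
  let ?U = "int (card ((C1 \<union> C2) \<inter> {0..<l}))"
  have "(C1 \<union> C2) \<inter> {0..<l} = C1 \<inter> {0..<l} \<union> (C2 - C1) \<inter> {0..<l}"
       "(C1 \<union> C2) \<inter> {0..<l} = C2 \<inter> {0..<l} \<union> (C1 - C2) \<inter> {0..<l}" by auto
  then have U: "?U = int (card (C1 \<inter> {0..<l})) + int (card ((C2 - C1) \<inter> {0..<l}))"
    "?U = int (card (C2 \<inter> {0..<l})) + int (card ((C1 - C2) \<inter> {0..<l}))"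
    by (metis (no_types) card_Un_disjoint finite_Int finite_atLeastLessThan_int of_nat_add
        Diff_disjoint Int_assoc Int_commute Int_empty_left Int_left_commute)+
  \<comment> \<open>\<open>grid_bound\<close> is used in both orders. If each use yields only its
    third alternative, the two add up to |C1| + |C2| + \<open>l div d1\<close> +
    \<open>l div d2\<close> <= 2 \<open>?U\<close>, and one of the disjuncts follows again.\<close>
  have "int (card (C1 \<inter> {0..<l})) + l div d1 \<le> ?U + 1 \<or> int (card (C2 \<inter> {0..<l})) + l div d2 \<le> ?U + 1"
    using grid_bound[OF d1(1) d2(1) d1(3) d2(3) c(1,2)] grid_bound[OF d2(1) d1(1) d2(3) d1(3) c(3,4)] U
    unfolding l_def lcm.commute[of d2 d1] by linarith
  then have "m * (int (card (C1 \<inter> {0..<l})) + l div d1) \<le> m * (?U + 1) \<or>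
    m * (int (card (C2 \<inter> {0..<l})) + l div d2) \<le> m * (?U + 1)"
    using mpos by simp
  then have "N \<le> m * (?U + 1)"
    using d1(4) d2(4) sc[OF p(1)] sc[OF p(2)] q by (auto simp: distrib_left)
  then have "N \<le> int (card ((C1 \<union> C2) \<inter> {0..<n})) + n div l"
    using sc[OF periodic_Un[OF p]] q by (simp add: distrib_left)
  then show ?thesis unfolding kneser_bound_def
    using lpos \<open>l dvd n\<close> periodic_Un[OF p] by blast
qed

lemma kneser_bound_UN:
  assumes "n > 0" "finite S" "S \<noteq> {}" "\<And>s. s \<in> S \<Longrightarrow> kneser_bound n N (f s)"
  shows "kneser_bound n N (\<Union>s\<in>S. f s)"
  using assms(2-4)
  by (induction S rule: finite_ne_induct) (simp_all add: kneser_bound_Un[OF assms(1)])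

text \<open>Dyson's transform: as long as A + (B - b) is not contained in A, elements are moved from B to A
  without changing the sum of the cardinalities. Once it is contained in A, the translate A + b
  serves as C, since then B - b consists of periods of A.\<close>

lemma kneser_local:
  assumes "n > 0" "periodic n A" "periodic n B" "a \<in> A" "b \<in> B"
  shows "\<exists>C \<subseteq> A + B. a + b \<in> C \<and>
    kneser_bound n (int (card (A \<inter> {0..<n})) + int (card (B \<inter> {0..<n}))) C"
  using assms(2-)
proof (induction "card (B \<inter> {0..<n})" arbitrary: A B rule: less_induct)
  case less
  show ?case
  proof (cases "\<forall>x\<in>A. \<forall>y\<in>B. x + (y - b) \<in> A")
    case True
    let ?C = "{x. x - b \<in> A}"
    obtain d where d: "d > 0" "periodic d A" "\<And>h. periodic h A \<Longrightarrow> d dvd h"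
      using obtain_least_period[OF less.prems(1) assms(1)] by blast
    have "?C \<subseteq> A + B"
    proof
      fix x assume "x \<in> ?C"
      then have "(x - b) + b \<in> A + B" using less.prems by (intro set_plus_intro) auto
      then show "x \<in> A + B" by simp
    qed
    moreover have "a + b \<in> ?C" using less.prems by simp
    moreover have "kneser_bound n (int (card (A \<inter> {0..<n})) + int (card (B \<inter> {0..<n}))) ?C"
    proof -
      have dn: "d dvd n" using d less.prems by blast
      \<comment> \<open>\<open>B\<close> lies in a single class modulo \<open>d\<close>, so it has
        at most \<open>n div d\<close> residues modulo \<open>n\<close>, while the translate
        \<open>?C\<close> has as many as \<open>A\<close>.\<close>
      have "y mod d = b mod d" if "y \<in> B" for y
        using d(3)[OF periodic_if_stable[OF less.prems(1) assms(1), of "y - b"]] True that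
        by (simp add: mod_eq_dvd_iff)
      then have "B \<inter> {0..<n} \<subseteq> {x. x mod d = b mod d} \<inter> {0..<n}" by auto
      then have "card (B \<inter> {0..<n}) \<le> card ({x. x mod d = b mod d} \<inter> {0..<n})"
        by (rule card_mono[rotated]) simp
      then have "int (card (B \<inter> {0..<n})) \<le> n div d"
        using card_residue_class[OF d(1) dn assms(1), of b] by linarith
      then show ?thesis unfolding kneser_bound_def
        using d dn periodic_translate[OF d(2)] card_translate[OF less.prems(1) assms(1)] by auto
    qed
    ultimately show ?thesis by blast
  next
    case False
    then obtain x y where xy: "x \<in> A" "y \<in> B" "x + (y - b) \<notin> A" by blast
    \<comment> \<open>\<open>A'\<close> is the union of \<open>A\<close> and B + e, and
      \<open>B'\<close> is the intersection of \<open>B\<close> and A - e. The choice of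
      \<open>e\<close> keeps \<open>b\<close> in \<open>B'\<close>, since b + e = x, and removes
      \<open>y\<close>, since y + e is not in \<open>A\<close>.\<close>
    define e where "e = x - b"
    define A' B' where "A' = A \<union> {z. z - e \<in> B}" and "B' = {z. z - (- e) \<in> A \<inter> {z. z - e \<in> B}}"
    have B': "B' \<subseteq> B" "y \<notin> B'" using xy by (auto simp: B'_def e_def algebra_simps)
    have pB: "periodic n {z. z - e \<in> B}" using less.prems by (simp add: periodic_translate)
    have pI: "periodic n (A \<inter> {z. z - e \<in> B})" using less.prems(1) pB by (auto simp: periodic_def)
    have pA': "periodic n A'" unfolding A'_def using less.prems(1) pB by (rule periodic_Un)
    have pB': "periodic n B'" unfolding B'_def using pI by (rule periodic_translate)
    have "card (A' \<inter> {0..<n}) + card (B' \<inter> {0..<n}) =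
        card (A' \<inter> {0..<n}) + card ((A \<inter> {z. z - e \<in> B}) \<inter> {0..<n})"
      unfolding B'_def card_translate[OF pI assms(1)] ..
    also have "\<dots> = card (A \<inter> {0..<n}) + card ({z. z - e \<in> B} \<inter> {0..<n})"
      using card_Un_Int[of "A \<inter> {0..<n}" "{z. z - e \<in> B} \<inter> {0..<n}"]
      by (simp add: A'_def Int_Un_distrib Int_Un_distrib2 Int_ac)
    finally have sum: "card (A' \<inter> {0..<n}) + card (B' \<inter> {0..<n}) = card (A \<inter> {0..<n}) + card (B \<inter> {0..<n})"
      using card_translate[OF less.prems(2) assms(1)] by simp
    have "y mod n \<in> B \<inter> {0..<n}" "y mod n \<notin> B' \<inter> {0..<n}"
      using B' xy periodic_mod[OF less.prems(2)] periodic_mod[OF pB'] assms(1) by auto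
    then have "card (B' \<inter> {0..<n}) < card (B \<inter> {0..<n})"
      using B' by (intro psubset_card_mono) auto
    then obtain C where C: "C \<subseteq> A' + B'" "a + b \<in> C"
      "kneser_bound n (int (card (A' \<inter> {0..<n})) + int (card (B' \<inter> {0..<n}))) C"
      using less.hyps[OF _ pA' pB'] less.prems xy by (force simp: A'_def B'_def e_def)
    have "A' + B' \<subseteq> A + B"
    proof (rule subsetI, elim set_plus_elim)
      fix z p q assume z: "z = p + q" "p \<in> A'" "q \<in> B'"
      show "z \<in> A + B"
      proof (cases "p \<in> A")
        case True
        then show ?thesis using z B' by blast
      next
        case False
        \<comment> \<open>Shifting by \<open>e\<close> exchanges the roles of the two summands:
          \<open>q\<close> moves into \<open>A\<close> and \<open>p\<close> into
          \<open>B\<close>.\<close>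
        then have "p - e \<in> B" "q + e \<in> A" using z by (auto simp: A'_def B'_def)
        then have "(q + e) + (p - e) \<in> A + B" by blast
        then show ?thesis using z by (simp add: algebra_simps)
      qed
    qed
    then show ?thesis using C sum by (metis of_nat_add order_trans)
  qed
qed

text \<open>Each element of A + B lies in a piece of A + B satisfying the bound. The pieces are
  \<open>n\<close>-periodic, so those of the finitely many elements in \<open>{0..<n}\<close>
  already cover A + B, and the union lemma applies.\<close>

lemma kneser_periodic:
  assumes "n > 0" "periodic n A" "periodic n B" "A \<noteq> {}" "B \<noteq> {}"
  shows "kneser_bound n (int (card (A \<inter> {0..<n})) + int (card (B \<inter> {0..<n}))) (A + B)"
proof -
  let ?N = "int (card (A \<inter> {0..<n})) + int (card (B \<inter> {0..<n}))"
  let ?S = "(A + B) \<inter> {0..<n}"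
  have "\<forall>c\<in>A + B. \<exists>C \<subseteq> A + B. c \<in> C \<and> kneser_bound n ?N C"
    using kneser_local[OF assms(1-3)] by (auto elim!: set_plus_elim)
  then obtain f where f: "\<And>c. c \<in> A + B \<Longrightarrow> f c \<subseteq> A + B \<and> c \<in> f c \<and> kneser_bound n ?N (f c)"
    by metis
  have m: "z mod n \<in> ?S" if "z \<in> A + B" for z
    using periodic_mod[OF periodic_sumset[OF assms(2)]] that assms(1) by simp
  have "A + B = (\<Union>c\<in>?S. f c)"
  proof (intro equalityI subsetI)
    fix z assume z: "z \<in> A + B"
    have "kneser_bound n ?N (f (z mod n))" "z mod n \<in> f (z mod n)" using f m[OF z] by auto
    then have "z \<in> f (z mod n)"
      unfolding kneser_bound_def using periodic_dvd periodic_mod by metis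
    then show "z \<in> (\<Union>c\<in>?S. f c)" using m[OF z] by blast
  qed (use f in blast)
  moreover have "?S \<noteq> {}" using m assms(4,5) by (metis empty_iff ex_in_conv set_plus_intro)
  ultimately show ?thesis using kneser_bound_UN[OF assms(1), of ?S ?N f] f by auto
qed

section \<open>Kneser's theorem for arbitrary nonempty sets of integers\<close>

definition residues :: "int \<Rightarrow> int set \<Rightarrow> int set" where
  "residues n X = (\<lambda>x. x mod n) ` X"

text \<open>This is X + nZ, the least \<open>n\<close>-periodic set containing
  \<open>X\<close>.\<close>

definition periodize :: "int \<Rightarrow> int set \<Rightarrow> int set" where
  "periodize n X = {x. x mod n \<in> residues n X}"

lemma residues_mono: "X \<subseteq> Y \<Longrightarrow> residues n X \<subseteq> residues n Y"
  by (auto simp: residues_def)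

lemma finite_residues [simp]: "finite X \<Longrightarrow> finite (residues n X)"
  by (simp add: residues_def)

lemma residues_subset: "n > 0 \<Longrightarrow> residues n X \<subseteq> {0..<n}"
  by (auto simp: residues_def)

lemma periodic_periodize: "periodic n (periodize n X)"
  by (simp add: periodic_def periodize_def)

lemma periodize_Int: "n > 0 \<Longrightarrow> periodize n X \<inter> {0..<n} = residues n X"
  using residues_subset[of n X] by (auto simp: periodize_def)

lemma subset_periodize: "X \<subseteq> periodize n X"
  by (auto simp: periodize_def residues_def)

lemma periodize_least: "periodic n Y \<Longrightarrow> X \<subseteq> Y \<Longrightarrow> periodize n X \<subseteq> Y"
  unfolding periodize_def residues_def using periodic_cong by blast

lemma periodize_sumset: "periodize n (X + Y) = periodize n X + periodize n Y"
proof
  show "periodize n (X + Y) \<subseteq> periodize n X + periodize n Y"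
    by (intro periodize_least periodic_sumset periodic_periodize set_plus_mono2 subset_periodize)
  show "periodize n X + periodize n Y \<subseteq> periodize n (X + Y)"
  proof (rule subsetI, elim set_plus_elim)
    fix z p q assume z: "z = p + q" "p \<in> periodize n X" "q \<in> periodize n Y"
    then obtain x y where "x \<in> X" "y \<in> Y" "p mod n = x mod n" "q mod n = y mod n"
      by (auto simp: periodize_def residues_def)
    then show "z \<in> periodize n (X + Y)"
      unfolding periodize_def residues_def z(1)
      by (auto intro!: image_eqI[of _ _ "x + y"] set_plus_intro mod_add_cong)
  qed
qed

text \<open>Take \<open>d\<close> to be the generator of all periods of A + B modulo
  \<open>n\<close> and apply the periodic version modulo \<open>d\<close> instead of
  \<open>n\<close>. The period \<open>d'\<close> it returns must equal \<open>d\<close>, so its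
  subgroup is trivial and contributes just 1.\<close>

theorem kneser:
  assumes "n > 0" "A \<noteq> {}" "B \<noteq> {}"
  obtains d where "d > 0" "d dvd n" "periodic d (periodize n (A + B))"
    "card (residues d A) + card (residues d B) \<le> card (residues d (A + B)) + 1"
proof -
  let ?C = "periodize n (A + B)"
  obtain d where d: "d > 0" "periodic d ?C" "\<And>h. periodic h ?C \<Longrightarrow> d dvd h"
    using obtain_least_period[OF periodic_periodize assms(1)] by blast
  have dn: "d dvd n" using d(3) periodic_periodize by blast
  have C: "?C = periodize d (A + B)"
    by (intro equalityI periodize_least subset_periodize d periodic_dvd[OF periodic_periodize dn])
  have "periodize d A \<noteq> {}" "periodize d B \<noteq> {}" using assms subset_periodize by blast+
  then have "kneser_bound d (int (card (residues d A)) + int (card (residues d B))) ?C"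
    using kneser_periodic[OF d(1) periodic_periodize periodic_periodize, of A B]
    unfolding C by (simp add: periodize_sumset periodize_Int d(1))
  then obtain d' where d': "d' > 0" "d' dvd d" "periodic d' ?C"
    "int (card (residues d A)) + int (card (residues d B)) \<le> int (card (?C \<inter> {0..<d})) + d div d'"
    unfolding kneser_bound_def by blast
  have "d' = d" using d' d by (simp add: zdvd_antisym_nonneg)
  then have "card (residues d A) + card (residues d B) \<le> card (residues d (A + B)) + 1"
    using d'(4) d(1) by (simp add: C periodize_Int)
  then show ?thesis using that d dn by blast
qed

section \<open>Elementary counts of sums and residues\<close>

text \<open>The translates X + Min Y and Max X + Y lie in the sumset and share only the element Max
  X + Min Y.\<close>

lemma card_sumset_ge:
  fixes X Y :: "int set"
  assumes "finite X" "finite Y" "X \<noteq> {}" "Y \<noteq> {}"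
  shows "card X + card Y \<le> card (X + Y) + 1"
proof -
  let ?P = "(\<lambda>x. x + Min Y) ` X" and ?Q = "(\<lambda>y. Max X + y) ` Y"
  have "card ?P = card X" "card ?Q = card Y" by (auto intro!: card_image simp: inj_on_def)
  moreover have "card (?P \<inter> ?Q) \<le> card {Max X + Min Y}"
  proof (rule card_mono)
    show "?P \<inter> ?Q \<subseteq> {Max X + Min Y}"
    proof safe
      fix x y assume "x \<in> X" "y \<in> Y" "x + Min Y = Max X + y"
      moreover have "x \<le> Max X" "Min Y \<le> y" using calculation assms by auto
      ultimately show "x + Min Y = Max X + Min Y" by linarith
    qed
  qed simp
  moreover have "card (?P \<union> ?Q) \<le> card (X + Y)"
    using assms by (intro card_mono finite_set_plus) (auto intro!: set_plus_intro Min_in Max_in)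
  ultimately show ?thesis using card_Un_Int[of ?P ?Q] assms by simp
qed

lemma card_ge_residues_add:
  assumes "finite S" "Y \<subseteq> S" "n > 0" "\<And>y. y \<in> Y \<Longrightarrow> y + n \<in> S"
  shows "card (residues n S) + card Y \<le> card S"
proof -
  txt \<open>The least elements of the classes are representatives outside of Y + n.\<close>
  define M where "M = {x \<in> S. \<forall>y\<in>S. y mod n = x mod n \<longrightarrow> x \<le> y}"
  have "residues n S \<subseteq> (\<lambda>x. x mod n) ` M"
  proof
    fix r assume r: "r \<in> residues n S"
    let ?R = "{x \<in> S. x mod n = r}"
    have fin: "finite ?R" "?R \<noteq> {}" using r assms by (auto simp: residues_def)
    have "Min ?R \<in> ?R" using Min_in[OF fin] .
    moreover have "Min ?R \<in> M" using calculation Min_le[OF fin(1)] by (auto simp: M_def)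
    ultimately show "r \<in> (\<lambda>x. x mod n) ` M" by (intro image_eqI[of _ _ "Min ?R"]) auto
  qed
  moreover have finM: "finite M" using assms(1) by (simp add: M_def)
  ultimately have "card (residues n S) \<le> card M" by (rule surj_card_le[rotated])
  moreover have "card ((\<lambda>y. y + n) ` Y) = card Y" by (rule card_image) (simp add: inj_on_def)
  moreover have "M \<inter> (\<lambda>y. y + n) ` Y = {}"
    using assms(2,3) by (fastforce simp: M_def)
  moreover have "finite Y" using assms finite_subset by blast
  moreover have "card (M \<union> (\<lambda>y. y + n) ` Y) \<le> card S"
    using assms by (intro card_mono) (auto simp: M_def)
  ultimately show ?thesis using finM by (simp add: card_Un_disjoint)
qed

text \<open>Only the end points 0 and \<open>n\<close> can collide modulo \<open>n\<close>.\<close>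

lemma card_le_Suc_card_residues:
  assumes "X \<subseteq> {0..n}" "n > 0"
  shows "card X \<le> card (residues n X) + 1"
proof -
  have fin: "finite X" using assms finite_subset by blast
  have "inj_on (\<lambda>x. x mod n) (X - {n})"
  proof (rule inj_onI)
    fix x y assume "x \<in> X - {n}" "y \<in> X - {n}" "x mod n = y mod n"
    moreover have "x \<in> {0..<n}" "y \<in> {0..<n}" using calculation assms by force+
    ultimately show "x = y" by simp
  qed
  then have "card (X - {n}) = card (residues n (X - {n}))" by (simp add: residues_def card_image)
  also have "\<dots> \<le> card (residues n X)" using fin by (intro card_mono residues_mono) auto
  finally show ?thesis using fin by (auto simp: card_Diff_singleton_if split: if_splits)
qed

section \<open>Small sumsets of integers\<close>

definition fiber :: "int \<Rightarrow> int set \<Rightarrow> int \<Rightarrow> int set" where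
  "fiber d X c = {x \<in> X. x mod d = c}"

lemma finite_fiber [simp]: "finite X \<Longrightarrow> finite (fiber d X c)"
  by (simp add: fiber_def)

lemma card_eq_sum_fibers:
  assumes "finite X" "residues d X \<subseteq> R" "finite R"
  shows "card X = (\<Sum>c\<in>R. card (fiber d X c))"
proof -
  have "X = (\<Union>c\<in>R. fiber d X c)" using assms(2) by (auto simp: fiber_def residues_def)
  moreover have "card (\<Union>c\<in>R. fiber d X c) = (\<Sum>c\<in>R. card (fiber d X c))"
    using assms by (intro card_UN_disjoint) (auto simp: fiber_def)
  ultimately show ?thesis by simp
qed

text \<open>Each of the other classes modulo \<open>d\<close> that \<open>X\<close> meets accounts
  for at most \<open>n div d\<close> residues modulo \<open>n\<close>, and passing from
  \<open>X\<close> to its residues loses at most 1. A large \<open>X\<close> thus leaves few holes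
  in any class that it meets.\<close>

lemma card_le_fiber:
  assumes "X \<subseteq> {0..n}" "n > 0" "d > 0" "d dvd n" "i \<in> residues d X"
  shows "int (card X) \<le> int (card (fiber d X i)) + (int (card (residues d X)) - 1) * (n div d) + 1"
proof -
  have fin: "finite X" using assms finite_subset by blast
  let ?R = "residues d X - {i}" and ?K = "\<lambda>c. {x. x mod d = c mod d} \<inter> {0..<n}"
  have "residues n X \<subseteq> residues n (fiber d X i) \<union> (\<Union>c\<in>?R. ?K c)"
  proof
    fix r assume "r \<in> residues n X"
    then obtain x where x: "x \<in> X" "r = x mod n" by (auto simp: residues_def)
    show "r \<in> residues n (fiber d X i) \<union> (\<Union>c\<in>?R. ?K c)"
    proof (cases "x mod d = i")
      case True
      then show ?thesis using x by (auto simp: residues_def fiber_def)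
    next
      case False
      then have "x mod d \<in> ?R" using x by (auto simp: residues_def)
      moreover have "r \<in> ?K (x mod d)" using x assms by (simp add: mod_mod_cancel)
      ultimately show ?thesis by blast
    qed
  qed
  then have "card (residues n X) \<le> card (residues n (fiber d X i) \<union> (\<Union>c\<in>?R. ?K c))"
    using fin by (intro card_mono) auto
  also have "\<dots> \<le> card (residues n (fiber d X i)) + (\<Sum>c\<in>?R. card (?K c))"
    using fin by (intro order_trans[OF card_Un_le] add_left_mono card_UN_le) auto
  also have "\<dots> \<le> card (fiber d X i) + (\<Sum>c\<in>?R. card (?K c))"
    using fin by (intro add_right_mono) (simp add: residues_def card_image_le)
  finally have "int (card (residues n X)) \<le> int (card (fiber d X i)) + (\<Sum>c\<in>?R. int (card (?K c)))"
    by (metis of_nat_add of_nat_le_iff of_nat_sum)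
  also have "(\<Sum>c\<in>?R. int (card (?K c))) = int (card ?R) * (n div d)"
    using card_residue_class[OF assms(3,4,2)] by simp
  also have "int (card ?R) = int (card (residues d X)) - 1"
    using assms(5) fin by (simp add: card_Diff_singleton of_nat_diff card_gt_0_iff Suc_le_eq) (metis card_gt_0_iff empty_iff finite_residues of_nat_diff Suc_leI of_nat_1 One_nat_def)
  finally show ?thesis using card_le_Suc_card_residues[OF assms(1,2)] by linarith
qed

text \<open>The period \<open>d\<close> from Kneser's theorem is shown to be 1. Let \<open>u\<close>
  be the number of classes modulo \<open>d\<close> met by \<open>A\<close>; for
  \<open>d > 1\<close>, the case \<open>u = 1\<close> contradicts the second bound in
  \<open>small\<close> and \<open>u >= 2\<close> the first.\<close>

lemma sumset_covers_residues:
  assumes sub: "A \<subseteq> {0..a}" "B \<subseteq> {0..a}" and mem: "0 \<in> A" "a \<in> A" "0 \<in> B" and "a > 0"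
    and gcd1: "\<And>d. d > 1 \<Longrightarrow> \<exists>x \<in> A \<union> B. \<not> d dvd x"
    and small: "card (A + B) + 4 \<le> card A + 2 * card B" "card (A + B) + 4 \<le> 2 * card A + card B"
  shows "residues a (A + B) = {0..<a}"
proof -
  let ?S = "A + B"
  have fin: "finite A" "finite B" using sub finite_subset by blast+
  then have finS: "finite ?S" by (simp add: finite_set_plus)
  define N \<alpha> \<beta> where "N = int (card ?S)" and "\<alpha> = int (card A)" and "\<beta> = int (card B)"
  have small': "N + 4 \<le> \<alpha> + 2 * \<beta>" "N + 4 \<le> 2 * \<alpha> + \<beta>"
    using small by (simp_all add: N_def \<alpha>_def \<beta>_def)
  have BS: "B \<subseteq> ?S" using set_plus_intro[OF mem(1)] by fastforce
  have ne: "A \<noteq> {}" "B \<noteq> {}" using mem by auto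
  obtain d where d: "d > 0" "d dvd a" "periodic d (periodize a ?S)"
    "card (residues d A) + card (residues d B) \<le> card (residues d ?S) + 1"
    using kneser[OF \<open>a > 0\<close> ne] by blast
  define h where "h = a div d"
  have hpos: "h > 0" using d \<open>a > 0\<close> by (simp add: h_def pos_imp_zdiv_pos_iff zdvd_imp_le)
  define u v where "u = int (card (residues d A))" and "v = int (card (residues d B))"
  have zero: "0 \<in> residues d A" "0 \<in> residues d B" using mem by (force simp: residues_def)+
  have pos: "u \<ge> 1" "v \<ge> 1" using zero fin
    by (metis card_gt_0_iff empty_iff finite_residues int_one_le_iff_zero_less of_nat_0_less_iff u_def v_def)+
  have RBS: "residues d B \<subseteq> residues d ?S" using BS by (rule residues_mono)
  define w where "w = int (card (residues d ?S - residues d B))"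
  have w: "int (card (residues d ?S)) = v + w"
    using card_Diff_subset[OF _ RBS] card_mono[OF _ RBS] fin finS by (simp add: v_def w_def)
  then have wu: "w \<ge> u - 1" using d(4) by (simp add: u_def v_def)
  define s where "s = (\<lambda>c. int (card (fiber d ?S c)))"
  have S: "N = (\<Sum>c\<in>residues d B. s c) + (\<Sum>c\<in>residues d ?S - residues d B. s c)"
    using card_eq_sum_fibers[OF finS order_refl, of d] finS fin
      sum.subset_diff[OF RBS, of s] by (simp add: s_def N_def)
  have B: "\<beta> = (\<Sum>c\<in>residues d B. int (card (fiber d B c)))"
    using card_eq_sum_fibers[OF fin(2) order_refl, of d] fin by (simp add: \<beta>_def)
  \<comment> \<open>Modulo \<open>a\<close> the sumset is \<open>d\<close>-periodic, so a class
    modulo \<open>d\<close> that it meets contributes all of its \<open>h\<close> residues.\<close>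
  have full: "int (card (residues a (fiber d ?S c))) = h" if c: "c \<in> residues d ?S" for c
  proof -
    obtain x where x: "x \<in> ?S" "c = x mod d" using c by (auto simp: residues_def)
    have "{r. r mod d = x mod d} \<inter> {0..<a} \<subseteq> residues a (fiber d ?S c)"
    proof
      fix r assume r: "r \<in> {r. r mod d = x mod d} \<inter> {0..<a}"
      have "x \<in> periodize a ?S" using x subset_periodize by blast
      then have "r \<in> periodize a ?S" using periodic_cong[OF d(3)] r by blast
      then obtain y where y: "y \<in> ?S" "y mod a = r" using r by (auto simp: periodize_def residues_def)
      then have "y mod d = r mod d" using d(2) by (metis mod_mod_cancel)
      then show "r \<in> residues a (fiber d ?S c)" using y r x by (auto simp: residues_def fiber_def)
    qed
    moreover have "residues a (fiber d ?S c) \<subseteq> {r. r mod d = x mod d} \<inter> {0..<a}"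
      using d(2) x \<open>a > 0\<close> by (auto simp: residues_def fiber_def mod_mod_cancel)
    ultimately have "residues a (fiber d ?S c) = {r. r mod d = x mod d} \<inter> {0..<a}" by simp
    then show ?thesis using card_residue_class[OF d(1,2) \<open>a > 0\<close>, of x] by (simp add: h_def)
  qed
  \<comment> \<open>Besides one representative for each of the \<open>h\<close> residues, every
    element \<open>y\<close> of \<open>B\<close> in the class yields an extra one, as
    \<open>y\<close> and \<open>y + a\<close> are both in the sumset.\<close>
  have inB: "h + int (card (fiber d B c)) \<le> s c" if c: "c \<in> residues d B" for c
  proof -
    have "y + a \<in> fiber d ?S c" if "y \<in> fiber d B c" for y
    proof -
      have "a + y \<in> ?S" using that mem by (auto simp: fiber_def)
      moreover have "(y + a) mod d = y mod d" using d(2) by (metis dvd_def mod_mult_self2)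
      ultimately show ?thesis using that by (simp add: fiber_def add.commute)
    qed
    then have "card (residues a (fiber d ?S c)) + card (fiber d B c) \<le> card (fiber d ?S c)"
      using BS finS \<open>a > 0\<close> by (intro card_ge_residues_add) (auto simp: fiber_def)
    then show ?thesis using full[of c] c RBS by (auto simp: s_def)
  qed
  then have sumB: "v * h + \<beta> \<le> (\<Sum>c\<in>residues d B. s c)"
    using sum_mono[of "residues d B" "\<lambda>c. h + int (card (fiber d B c))" s] by (simp add: sum.distrib B v_def)
  have sh: "h \<le> s c" if "c \<in> residues d ?S" for c
    using full[OF that] card_image_le[OF finite_fiber[OF finS], of "\<lambda>x. x mod a" d c]
    by (simp add: s_def residues_def)
  have pair: "int (card (fiber d A i)) + int (card (fiber d B j)) - 1 \<le> s ((i + j) mod d)"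
    if "i \<in> residues d A" "j \<in> residues d B" for i j
  proof -
    have "fiber d A i + fiber d B j \<subseteq> fiber d ?S ((i + j) mod d)"
      by (rule subsetI, elim set_plus_elim) (auto simp: fiber_def mod_add_eq)
    then have "card (fiber d A i + fiber d B j) \<le> card (fiber d ?S ((i + j) mod d))"
      using finS by (intro card_mono) auto
    moreover have "fiber d A i \<noteq> {}" "fiber d B j \<noteq> {}"
      using that by (auto simp: fiber_def residues_def)
    ultimately show ?thesis
      using card_sumset_ge[of "fiber d A i" "fiber d B j"] fin by (simp add: s_def)
  qed
  have "d = 1"
  proof (rule ccontr)
    assume "d \<noteq> 1"
    then have d1: "d > 1" using d(1) by simp
    show False
    proof (cases "u = 1")
      case True
      \<comment> \<open>Here \<open>A\<close> consists of multiples of \<open>d\<close>, so by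
        \<open>gcd1\<close> the set \<open>B\<close> meets at least two classes. Each of them
        receives a full copy of \<open>A\<close> plus a fiber of \<open>B\<close>, which makes the
        sumset too large.\<close>
      then have RA: "residues d A = {0}" using zero by (auto simp: u_def card_1_singleton_iff)
      then have "\<forall>x\<in>A. d dvd x" by (auto simp: residues_def)
      have "v \<noteq> 1"
      proof
        assume "v = 1"
        then have "residues d B = {0}" using zero by (auto simp: v_def card_1_singleton_iff)
        then have "\<forall>x\<in>B. d dvd x" by (auto simp: residues_def)
        then show False using gcd1[OF d1] \<open>\<forall>x\<in>A. d dvd x\<close> by blast
      qed
      have "fiber d A 0 = A" using \<open>\<forall>x\<in>A. d dvd x\<close> by (auto simp: fiber_def)
      then have "\<alpha> - 1 + int (card (fiber d B c)) \<le> s c" if "c \<in> residues d B" for c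
        using pair[OF zero(1) that] that by (auto simp: residues_def \<alpha>_def)
      then have "v * (\<alpha> - 1) + \<beta> \<le> (\<Sum>c\<in>residues d B. s c)"
        using sum_mono[of "residues d B" "\<lambda>c. \<alpha> - 1 + int (card (fiber d B c))" s]
        by (simp add: sum.distrib B v_def)
      moreover have "(\<Sum>c\<in>residues d ?S - residues d B. s c) \<ge> 0" by (simp add: sum_nonneg s_def)
      moreover have "2 * (\<alpha> - 1) + \<beta> \<le> v * (\<alpha> - 1) + \<beta>"
      proof -
        have "\<alpha> \<ge> 1" using fin ne by (simp add: \<alpha>_def Suc_le_eq card_gt_0_iff)
        then show ?thesis
          using pos \<open>v \<noteq> 1\<close> by (intro add_right_mono mult_right_mono) auto
      qed
      ultimately have "2 * (\<alpha> - 1) + \<beta> \<le> N"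
        unfolding S by (metis (no_types) add_increasing2 order_trans)
      then show False using small' by presburger
    next
      case False
      then have u2: "u \<ge> 2" using pos by simp
      txt \<open>By Kneser's theorem at least u - 1 classes of the sumset miss B; t is a lower bound for
        the size of each of them, which relies on A and B having few holes in their classes.\<close>
      define q where "q = \<alpha> + \<beta> - 2"
      define t where "t = q - 1 - (u + v - 2) * h"
      have "w * h \<le> (\<Sum>c\<in>residues d ?S - residues d B. s c)"
        using sum_mono[of "residues d ?S - residues d B" "\<lambda>_. h" s] sh by (simp add: w_def)
      moreover have "(u - 1) * h \<le> w * h" using wu hpos by (intro mult_right_mono) auto
      ultimately have "v * h + (u - 1) * h \<le> q - 2" using S sumB small' by (simp add: q_def)
      then have t: "t \<ge> h + 1" by (simp add: t_def algebra_simps)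
      have "t \<le> s c" if c: "c \<in> residues d ?S - residues d B" for c
      proof -
        obtain x y where xy: "x \<in> A" "y \<in> B" "c = (x + y) mod d"
          using c by (auto simp: residues_def elim!: set_plus_elim)
        have m: "x mod d \<in> residues d A" "y mod d \<in> residues d B" using xy by (auto simp: residues_def)
        \<comment> \<open>The fibers have at least \<open>\<alpha> - (u - 1) * h - 1\<close> and
          \<open>\<beta> - (v - 1) * h - 1\<close> elements; their sum minus 1 is
          \<open>t\<close>.\<close>
        have "t \<le> int (card (fiber d A (x mod d))) + int (card (fiber d B (y mod d))) - 1"
          using card_le_fiber[OF sub(1) \<open>a > 0\<close> d(1,2) m(1)] card_le_fiber[OF sub(2) \<open>a > 0\<close> d(1,2) m(2)]
          by (simp add: t_def q_def u_def v_def h_def \<alpha>_def \<beta>_def algebra_simps)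
        then show ?thesis using pair[OF m] xy by (simp add: mod_add_eq)
      qed
      then have "w * t \<le> (\<Sum>c\<in>residues d ?S - residues d B. s c)"
        using sum_mono[of "residues d ?S - residues d B" "\<lambda>_. t" s] by (simp add: w_def)
      moreover have "(u - 1) * t \<le> w * t" using wu t hpos by (intro mult_right_mono) auto
      moreover have "(u - 2) * h \<le> (u - 2) * t" using u2 t by (intro mult_left_mono) auto
      \<comment> \<open>One class is counted with \<open>t\<close> and \<open>u - 2\<close> others
        with \<open>h\<close>. Inserting \<open>t\<close> and \<open>q\<close> turns the left side
        into \<open>\<alpha> + 2 * \<beta> - 3\<close>.\<close>
      ultimately have "v * h + \<beta> + t + (u - 2) * h \<le> N"
        using S sumB by (simp add: algebra_simps)
      then show False using small' by (simp add: t_def q_def algebra_simps)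
    qed
  qed
  then have "periodize a ?S = UNIV"
    using d(3) mem BS subset_periodize[of ?S a] periodic_cong[of 1 "periodize a ?S" 0] by fastforce
  then show ?thesis using periodize_Int[OF \<open>a > 0\<close>, of ?S] by simp
qed

text \<open>For every \<open>r\<close> the classes of A and of r - B number more than
  \<open>n\<close> in total, so the two sets share a class.\<close>

lemma pigeonhole_residues:
  assumes "n > 0" "n < int (card (residues n A)) + int (card (residues n B))" "finite A" "finite B"
  shows "residues n (A + B) = {0..<n}"
proof (rule equalityI[OF residues_subset[OF assms(1)]], rule subsetI)
  fix r assume r: "r \<in> {0..<n}"
  let ?Y = "(\<lambda>y. (r - y) mod n) ` residues n B"
  have "inj_on (\<lambda>y. (r - y) mod n) (residues n B)"
  proof (rule inj_onI)
    fix x y assume xy: "x \<in> residues n B" "y \<in> residues n B" "(r - x) mod n = (r - y) mod n"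
    then have "(r - (r - x)) mod n = (r - (r - y)) mod n" by (metis mod_diff_cong)
    then show "x = y" using xy residues_subset[OF assms(1), of B] by (auto simp: residues_def)
  qed
  then have cY: "card ?Y = card (residues n B)" by (rule card_image)
  have "residues n A \<inter> ?Y \<noteq> {}"
  proof
    assume e: "residues n A \<inter> ?Y = {}"
    have "card (residues n A \<union> ?Y) \<le> card {0..<n}"
      using residues_subset[OF assms(1)] assms(1) by (intro card_mono) auto
    then show False using card_Un_disjoint[OF _ _ e] cY assms by simp
  qed
  then obtain x y where xy: "x \<in> A" "y \<in> B" "x mod n = (r - y mod n) mod n"
    by (auto simp: residues_def)
  then have "(x + y) mod n = r mod n" by (metis diff_add_cancel mod_add_cong mod_diff_right_eq)
  then show "r \<in> residues n (A + B)"
    using xy r by (force simp: residues_def)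
qed

theorem three_k_minus_four:
  assumes sub: "A \<subseteq> {0..a}" "B \<subseteq> {0..b}" and mem: "0 \<in> A" "a \<in> A" "0 \<in> B" "b \<in> B"
    and pos: "0 < b" "b \<le> a"
    and gcd1: "\<And>d. d > 1 \<Longrightarrow> \<exists>x \<in> A \<union> B. \<not> d dvd x"
    and small: "card (A + B) + 4 \<le> card A + card B + min (card A) (card B)"
  shows "a + int (card B) \<le> int (card (A + B))" "b + int (card A) \<le> int (card (A + B))"
proof -
  have fin: "finite A" "finite B" using sub finite_subset by blast+
  then have finS: "finite (A + B)" by (simp add: finite_set_plus)
  have S: "A \<subseteq> A + B" "B \<subseteq> A + B" "\<And>y. y \<in> B \<Longrightarrow> y + a \<in> A + B" "\<And>x. x \<in> A \<Longrightarrow> x + b \<in> A + B"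
    using mem set_plus_intro[of _ A 0 B] set_plus_intro[of 0 A _ B] set_plus_intro[of a A _ B]
    by (fastforce simp: add.commute)+
  have "residues a (A + B) = {0..<a}"
    using sub pos mem gcd1 small by (intro sumset_covers_residues) auto
  then show 1: "a + int (card B) \<le> int (card (A + B))"
    using card_ge_residues_add[OF finS S(2) _ S(3)] pos by force
  have "int (card (A \<inter> {0..<b})) \<le> int (card (residues b A))"
  proof -
    have "A \<inter> {0..<b} \<subseteq> residues b A" by (force simp: residues_def)
    then show ?thesis using fin by (simp add: card_mono)
  qed
  moreover have "int (card A) \<le> int (card (A \<inter> {0..<b})) + (a - b + 1)"
  proof -
    have "card A \<le> card (A \<inter> {0..<b} \<union> {b..a})" using sub by (intro card_mono) auto
    also have "\<dots> \<le> card (A \<inter> {0..<b}) + card {b..a}" by (rule card_Un_le)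
    finally show ?thesis using pos by simp
  qed
  moreover have "card B \<le> card (residues b B) + 1"
    using card_le_Suc_card_residues sub pos by blast
  \<comment> \<open>In total \<open>A\<close> and \<open>B\<close> meet at least |A| + |B| - 2 - (a
    - b) classes modulo \<open>b\<close>. Since a <= |A + B| - |B| by the first bound,
    \<open>small\<close> makes this at least b + 2.\<close>
  ultimately have "residues b (A + B) = {0..<b}"
    using 1 small pos fin by (intro pigeonhole_residues) auto
  then show "b + int (card A) \<le> int (card (A + B))"
    using card_ge_residues_add[OF finS S(1) _ S(4)] pos by force
qed

section \<open>Degree tables\<close>

text \<open>This carries \<open>three_k_minus_four\<close> over to natural numbers. Swapping
  \<open>X\<close> and \<open>Y\<close> exchanges the two conclusions, so only Max Y <= Max X has to
  be treated.\<close>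

lemma Max_add_card_le_card_sumset:
  fixes X Y :: "nat set"
  assumes fin: "finite X" "finite Y" and zero: "0 \<in> X" "0 \<in> Y" and two: "card X \<ge> 2" "card Y \<ge> 2"
    and gcd1: "Gcd (X \<union> Y) = 1"
    and small: "card (sumset X Y) + 4 \<le> card X + card Y + min (card X) (card Y)"
  shows "Max X + card Y \<le> card (sumset X Y) \<and> Max Y + card X \<le> card (sumset X Y)"
proof -
  have le: "Max X + card Y \<le> card (sumset X Y) \<and> Max Y + card X \<le> card (sumset X Y)"
    if fin: "finite X" "finite Y" and zero: "0 \<in> X" "0 \<in> Y" and two: "card Y \<ge> 2"
      and gcd1: "Gcd (X \<union> Y) = 1" and ord: "Max Y \<le> Max X"
      and small: "card (sumset X Y) + 4 \<le> card X + card Y + min (card X) (card Y)"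
    for X Y :: "nat set"
  proof -
    let ?A = "int ` X" and ?B = "int ` Y"
    have ne: "X \<noteq> {}" "Y \<noteq> {}" using zero by auto
    have "int ` sumset X Y = ?A + ?B"
    proof (intro equalityI subsetI)
      fix z assume "z \<in> ?A + ?B"
      then obtain x y where xy: "x \<in> X" "y \<in> Y" "z = int (x + y)" by (auto elim!: set_plus_elim)
      then have "x + y \<in> sumset X Y" by (auto simp: sumset_def)
      then show "z \<in> int ` sumset X Y" using xy by blast
    qed (auto simp: sumset_def intro!: set_plus_intro)
    then have cS: "card (?A + ?B) = card (sumset X Y)"
      using card_image[of int "sumset X Y"] by (simp add: inj_on_def)
    have cA: "card ?A = card X" and cB: "card ?B = card Y" by (simp_all add: card_image)
    have "Max Y \<noteq> 0"
    proof
      assume "Max Y = 0"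
      then have "Y \<subseteq> {0}" using Max_ge[OF fin(2)] by fastforce
      then show False using card_mono[of "{0::nat}" Y] two by simp
    qed
    then have pos: "0 < int (Max Y)" "int (Max Y) \<le> int (Max X)" using ord by auto
    have sub: "?A \<subseteq> {0..int (Max X)}" "?B \<subseteq> {0..int (Max Y)}" using fin by auto
    have mem: "0 \<in> ?A" "int (Max X) \<in> ?A" "0 \<in> ?B" "int (Max Y) \<in> ?B"
      using zero fin ne Max_in by force+
    have nd: "\<exists>x \<in> ?A \<union> ?B. \<not> d dvd x" if "d > 1" for d :: int
    proof (rule ccontr)
      assume "\<not> ?thesis"
      then have "\<forall>x\<in>X \<union> Y. d dvd int x" by blast
      then have "nat d dvd Gcd (X \<union> Y)" using that by (intro Gcd_greatest) (simp add: nat_dvd_iff)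
      then show False using gcd1 that by simp
    qed
    have "int (Max X) + int (card Y) \<le> int (card (sumset X Y))"
      "int (Max Y) + int (card X) \<le> int (card (sumset X Y))"
      using three_k_minus_four[OF sub mem pos nd] small unfolding cS cA cB by blast+
    then show ?thesis by linarith
  qed
  show ?thesis
  proof (cases "Max Y \<le> Max X")
    case True
    then show ?thesis using le assms by blast
  next
    case False
    have "sumset Y X = sumset X Y" unfolding sumset_def by (metis add.commute)
    then show ?thesis using le[of Y X] assms False by (simp add: Un_commute min.commute add.commute)
  qed
qed

text \<open>In the table \<open>ap\<close>, \<open>bp\<close> the sums i + K j represent each number
  below K L exactly once, as in a mixed radix expansion. All entries of \<open>as\<close> and
  \<open>bs\<close> are at least K L and hence cannot disturb these sums. The largest entry on
  either side is K L + T - 1, so all sums are below 2 K L + 2 T - 1.\<close>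

lemma N_min_le:
  assumes "K > 0" "L > 0" "T > 0"
  shows "N_min K L T \<le> 2 * K * L + 2 * T - 1"
proof -
  define ap as bp bs where "ap = [0..<K]" and "as = [K * L..<K * L + T]"
    and "bp = map ((*) K) [0..<L]" and "bs = [K * L..<K * L + T]"
  have lt: "i + K * j < K * L" if "i < K" "j < L" for i j
  proof -
    have "i + K * j < K * Suc j" using that by simp
    also have "\<dots> \<le> K * L" using that by (intro mult_le_mono2) simp
    finally show ?thesis .
  qed
  have bplt: "y < K * L" if "y \<in> set bp" for y
    using that lt[of 0] assms by (auto simp: bp_def)
  have aplt: "x < K * L" if "x \<in> set ap" for x
    using that lt[of x 0] assms by (auto simp: ap_def)
  have "degree_table K L T ap as bp bs"
    unfolding degree_table_def
  proof (intro conjI ballI)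
    show "distinct (ap @ as)" using aplt by (fastforce simp: ap_def as_def)
    have "distinct bp" "distinct bs" using assms by (auto simp: bp_def bs_def distinct_map inj_on_def)
    then show "distinct (bp @ bs)" using bplt by (fastforce simp: bs_def)
    fix n assume "n \<in> sumset (set ap) (set bp)"
    then obtain i j where ij: "i < K" "j < L" "n = i + K * j"
      by (auto simp: sumset_def ap_def bp_def)
    show "\<exists>!p. p \<in> set (ap @ as) \<times> set (bp @ bs) \<and> fst p + snd p = n"
    proof (rule ex1I[of _ "(i, K * j)"])
      fix p assume p: "p \<in> set (ap @ as) \<times> set (bp @ bs) \<and> fst p + snd p = n"
      have "fst p < K * L" "snd p < K * L" using p lt[OF ij(1,2)] ij(3) by linarith+
      then have "fst p < K" "snd p \<in> set bp" using p by (auto simp: ap_def as_def bs_def)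
      then obtain j' where j': "snd p = K * j'" by (auto simp: bp_def)
      have e: "fst p + K * j' = i + K * j" using p ij j' by simp
      have "fst p = i"
        using arg_cong[OF e, of "\<lambda>x. x mod K"] ij \<open>fst p < K\<close> by simp
      then show "p = (i, K * j)" using e j' by (simp add: prod_eq_iff)
    qed (use ij in \<open>auto simp: ap_def bp_def\<close>)
  qed (simp_all add: ap_def as_def bp_def bs_def)
  then have "N_min K L T \<le> N_tab ap as bp bs" unfolding N_min_def by (intro Least_le) blast
  also have "\<dots> \<le> card {0..<2 * K * L + 2 * T - 1}"
    unfolding N_tab_def
  proof (intro card_mono subsetI)
    fix z assume "z \<in> sumset (set (ap @ as)) (set (bp @ bs))"
    then obtain x y where "z = x + y" "x \<in> set (ap @ as)" "y \<in> set (bp @ bs)"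
      by (auto simp: sumset_def)
    moreover have "x < K * L + T" using calculation aplt by (auto simp: as_def intro: trans_less_add1)
    moreover have "y < K * L + T" using calculation bplt by (auto simp: bs_def intro: trans_less_add1)
    ultimately show "z \<in> {0..<2 * K * L + 2 * T - 1}" by simp
  qed simp
  finally show ?thesis by simp
qed

theorem theorem7:
  fixes K L T :: nat and ap as bp bs :: "nat list"
  assumes "K > 0" and "L > 0" and "T > 0"
    and "2 * int K * int L - int K - int L - int (min K L) + 3 \<le> int T"
    and "degree_table K L T ap as bp bs"
    and "normal_table ap as bp bs"
    and "N_tab ap as bp bs = N_min K L T"
  shows "Max (set (ap @ as)) \<le> 2 * K * L + T - 1 - L \<and>
         Max (set (bp @ bs)) \<le> 2 * K * L + T - 1 - K"
proof -
  let ?X = "set (ap @ as)" and ?Y = "set (bp @ bs)"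
  have cX: "card ?X = K + T"
    using assms(5) distinct_card[of "ap @ as"] by (simp add: degree_table_def)
  have cY: "card ?Y = L + T"
    using assms(5) distinct_card[of "bp @ bs"] by (simp add: degree_table_def)
  have ne: "?X \<noteq> {}" "?Y \<noteq> {}" using cX cY assms(3) by (metis card.empty add_is_0 less_irrefl)+
  have zero: "0 \<in> ?X" "0 \<in> ?Y"
    using assms(6) Min_in[OF _ ne(1)] Min_in[OF _ ne(2)] by (auto simp: normal_table_def)
  have gcd1: "Gcd (?X \<union> ?Y) = 1" using assms(6) by (simp add: normal_table_def Un_assoc)
  have N: "card (sumset ?X ?Y) \<le> 2 * K * L + 2 * T - 1"
    using N_min_le[OF assms(1-3)] assms(7) by (simp add: N_tab_def)
  have KL: "K * L \<ge> 1" using assms(1,2) by (simp add: Suc_le_eq)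
  have "2 * K * L + 3 \<le> T + K + L + min K L"
  proof -
    have "int (2 * K * L + 3) \<le> int (T + K + L + min K L)" using assms(4) by simp
    then show ?thesis by (simp only: of_nat_le_iff)
  qed
  \<comment> \<open>With |X| = K + T, |Y| = L + T and |X + Y| <= 2 K L + 2 T - 1, the inequality
    reduces to the hypothesis on \<open>T\<close>.\<close>
  then have "card (sumset ?X ?Y) + 4 \<le> card ?X + card ?Y + min (card ?X) (card ?Y)"
    using N KL assms(3) unfolding cX cY by linarith
  then have "Max ?X + card ?Y \<le> card (sumset ?X ?Y) \<and> Max ?Y + card ?X \<le> card (sumset ?X ?Y)"
    using zero gcd1 cX cY assms(1-3) by (intro Max_add_card_le_card_sumset) auto
  then show ?thesis using N unfolding cX cY by linarith
qed

end
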